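(* Let $m$ be a positive integer. There exists a positive integer $M$ such that for all integers $n > M$, writing $N = \binom{n}{2}$, among all integers $e$ with $$N - \left\lfloor \frac{n}{2} \right\rfloor - m \leq e \leq N,$$ the probability $P_{n,e}$ is maximized when $e = N - \lfloor \frac{n}{2} \rfloor$.
   Context: Graphs are finite and simple, and unlabeled (i.e. considered up to isomorphism). In the game Lights Out on a graph $\Gamma$, each vertex is a light that is on or off, and pressing a vertex toggles that vertex and every vertex adjacent to it. Lights Out is universally solvable on $\Gamma$ if for every initial configuration $c \subseteq V\Gamma$ of lights that are on, there is a sequence of presses that turns off all lights. For integers $n \ge 1$ and $0 \le e \le \binom{n}{2}$, $\mathcal{G}_{n,e}$ denotes the set of unlabeled graphs (isomorphism classes of graphs) with $n$ vertices and $e$ edges, and $P_{n,e}$ denotes the probability that Lights Out is universally solvable on a graph chosen uniformly at random from $\mathcal{G}_{n,e}$, i.e. the number of elements of $\mathcal{G}_{n,e}$ on which Lights Out is universally solvable divided by $|\mathcal{G}_{n,e}|$. *)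

theory Defs
  imports Complex_Main "HOL-Library.Ramsey"
begin

text \<open>
  A finite simple graph is given by a finite vertex set \<open>V\<close> and an edge set \<open>E \<subseteq> [V]\<^bsup>2\<^esup>\<close>,
  where \<open>[V]\<^bsup>2\<^esup>\<close> is the library's set of two-element subsets of \<open>V\<close>.
\<close>

subsection \<open>Lights Out\<close>

definition closed_nbhd :: "'a set \<Rightarrow> 'a set set \<Rightarrow> 'a \<Rightarrow> 'a set" where
  "closed_nbhd V E v = {u \<in> V. u = v \<or> {u, v} \<in> E}"

text \<open>A configuration is the set of vertices whose light is on.\<close>

definition press :: "'a set \<Rightarrow> 'a set set \<Rightarrow> 'a \<Rightarrow> 'a set \<Rightarrow> 'a set" where
  "press V E v c = sym_diff c (closed_nbhd V E v)"

definition universally_solvable :: "'a set \<Rightarrow> 'a set set \<Rightarrow> bool" where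
  "universally_solvable V E \<longleftrightarrow>
     (\<forall>c. c \<subseteq> V \<longrightarrow> (\<exists>vs. set vs \<subseteq> V \<and> fold (press V E) vs c = {}))"

subsection \<open>Unlabeled graphs\<close>

definition graph_iso :: "'a set \<Rightarrow> 'a set set \<Rightarrow> 'b set \<Rightarrow> 'b set set \<Rightarrow> bool" where
  "graph_iso V E W F \<longleftrightarrow>
     (\<exists>f. bij_betw f V W \<and> (\<forall>u\<in>V. \<forall>v\<in>V. {u, v} \<in> E \<longleftrightarrow> {f u, f v} \<in> F))"

text \<open>
  Every graph with \<open>n\<close> vertices is isomorphic to one with vertex set \<open>{..<n}\<close>, so the isomorphism
  classes of graphs with \<open>n\<close> vertices and \<open>e\<close> edges are represented by the classes of
  isomorphic edge sets on \<open>{..<n}\<close>.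
\<close>

definition labeled_graphs :: "nat \<Rightarrow> nat \<Rightarrow> nat set set set" where
  "labeled_graphs n e = {E. E \<subseteq> [{..<n}]\<^bsup>2\<^esup> \<and> card E = e}"

definition iso_rel :: "nat \<Rightarrow> nat \<Rightarrow> (nat set set \<times> nat set set) set" where
  "iso_rel n e = {(E, F). E \<in> labeled_graphs n e \<and> F \<in> labeled_graphs n e \<and>
     graph_iso {..<n} E {..<n} F}"

definition unlabeled_graphs :: "nat \<Rightarrow> nat \<Rightarrow> nat set set set set" where
  "unlabeled_graphs n e = labeled_graphs n e // iso_rel n e"

text \<open>
  The choice of the representative \<open>E\<close> of the class \<open>C\<close> is immaterial, see
  \<open>universally_solvable_class_iff\<close> below.
\<close>

definition solvable_prob :: "nat \<Rightarrow> nat \<Rightarrow> real" where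
  "solvable_prob n e =
     real (card {C \<in> unlabeled_graphs n e. \<forall>E\<in>C. universally_solvable {..<n} E}) /
     real (card (unlabeled_graphs n e))"

subsection \<open>Well-definedness\<close>

lemma graph_iso_refl: "graph_iso V E V E"
  unfolding graph_iso_def by (rule exI[of _ id]) auto

lemma graph_iso_sym:
  assumes "graph_iso V E W F"
  shows "graph_iso W F V E"
proof -
  obtain f where f: "bij_betw f V W" "\<forall>u\<in>V. \<forall>v\<in>V. {u, v} \<in> E \<longleftrightarrow> {f u, f v} \<in> F"
    using assms unfolding graph_iso_def by blast
  let ?g = "inv_into V f"
  have g: "?g w \<in> V" "f (?g w) = w" if "w \<in> W" for w
    using f(1) that by (auto simp: bij_betw_def inv_into_into f_inv_into_f)
  have "bij_betw ?g W V" using f(1) by (rule bij_betw_inv_into)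
  moreover have "\<forall>u\<in>W. \<forall>v\<in>W. {u, v} \<in> F \<longleftrightarrow> {?g u, ?g v} \<in> E"
    using f(2) g by simp
  ultimately show ?thesis unfolding graph_iso_def by blast
qed

lemma graph_iso_trans:
  assumes "graph_iso V E W F" "graph_iso W F X G"
  shows "graph_iso V E X G"
proof -
  obtain f where f: "bij_betw f V W" "\<forall>u\<in>V. \<forall>v\<in>V. {u, v} \<in> E \<longleftrightarrow> {f u, f v} \<in> F"
    using assms(1) unfolding graph_iso_def by blast
  obtain g where g: "bij_betw g W X" "\<forall>u\<in>W. \<forall>v\<in>W. {u, v} \<in> F \<longleftrightarrow> {g u, g v} \<in> G"
    using assms(2) unfolding graph_iso_def by blast
  have "f v \<in> W" if "v \<in> V" for v using f(1) that by (auto simp: bij_betw_def)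
  then have "\<forall>u\<in>V. \<forall>v\<in>V. {u, v} \<in> E \<longleftrightarrow> {(g \<circ> f) u, (g \<circ> f) v} \<in> G"
    using f(2) g(2) by simp
  moreover have "bij_betw (g \<circ> f) V X" using f(1) g(1) by (rule bij_betw_trans)
  ultimately show ?thesis unfolding graph_iso_def by blast
qed

lemma equiv_iso_rel: "equiv (labeled_graphs n e) (iso_rel n e)"
proof (rule equivI)
  show "iso_rel n e \<subseteq> labeled_graphs n e \<times> labeled_graphs n e"
    by (auto simp: iso_rel_def)
  show "refl_on (labeled_graphs n e) (iso_rel n e)"
    by (auto simp: refl_on_def iso_rel_def graph_iso_refl)
  show "sym (iso_rel n e)"
    by (auto simp: sym_def iso_rel_def intro: graph_iso_sym)
  show "trans (iso_rel n e)"
    by (auto simp: trans_def iso_rel_def intro: graph_iso_trans)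
qed

lemma universally_solvable_iso:
  assumes "graph_iso V E W F" "universally_solvable V E"
  shows "universally_solvable W F"
proof -
  obtain f where f: "bij_betw f V W" "\<forall>u\<in>V. \<forall>v\<in>V. {u, v} \<in> E \<longleftrightarrow> {f u, f v} \<in> F"
    using assms(1) unfolding graph_iso_def by blast
  have inj: "inj_on f V" and img: "f ` V = W" using f(1) by (auto simp: bij_betw_def)
  have nb: "closed_nbhd W F (f v) = f ` closed_nbhd V E v" if "v \<in> V" for v
  proof (rule set_eqI)
    fix w
    have eq: "f u = f v \<or> {f u, f v} \<in> F \<longleftrightarrow> u = v \<or> {u, v} \<in> E" if "u \<in> V" for u
      using f(2) \<open>u \<in> V\<close> \<open>v \<in> V\<close> inj_on_eq_iff[OF inj] by blast
    have "w \<in> closed_nbhd W F (f v) \<longleftrightarrow> (\<exists>u\<in>V. w = f u \<and> (f u = f v \<or> {f u, f v} \<in> F))"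
      unfolding closed_nbhd_def img[symmetric] by blast
    also have "\<dots> \<longleftrightarrow> (\<exists>u\<in>V. w = f u \<and> (u = v \<or> {u, v} \<in> E))"
      using eq by (intro bex_cong refl conj_cong) auto
    also have "\<dots> \<longleftrightarrow> w \<in> f ` closed_nbhd V E v"
      unfolding closed_nbhd_def by blast
    finally show "w \<in> closed_nbhd W F (f v) \<longleftrightarrow> w \<in> f ` closed_nbhd V E v" .
  qed
  have pr: "press W F (f v) (f ` c) = f ` press V E v c" if "v \<in> V" "c \<subseteq> V" for v c
  proof -
    have N: "closed_nbhd V E v \<subseteq> V" by (auto simp: closed_nbhd_def)
    have "f ` (c - closed_nbhd V E v) = f ` c - f ` closed_nbhd V E v"
      using that N by (intro inj_on_image_set_diff[OF inj]) auto
    moreover have "f ` (closed_nbhd V E v - c) = f ` closed_nbhd V E v - f ` c"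
      using that N by (intro inj_on_image_set_diff[OF inj]) auto
    ultimately show ?thesis
      using that by (simp add: press_def nb image_Un)
  qed
  have sub: "press V E v c \<subseteq> V" if "c \<subseteq> V" for v c
    using that by (auto simp: press_def closed_nbhd_def)
  have fld: "fold (press W F) (map f vs) (f ` c) = f ` fold (press V E) vs c"
    if "set vs \<subseteq> V" "c \<subseteq> V" for vs c
    using that by (induction vs arbitrary: c) (auto simp: pr sub)
  show ?thesis
    unfolding universally_solvable_def
  proof (intro allI impI)
    fix d assume "d \<subseteq> W"
    then obtain c where c: "c \<subseteq> V" "d = f ` c" using img by (auto simp: subset_image_iff)
    then obtain vs where vs: "set vs \<subseteq> V" "fold (press V E) vs c = {}"
      using assms(2) unfolding universally_solvable_def by blast
    then have "set (map f vs) \<subseteq> W" "fold (press W F) (map f vs) d = {}"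
      using c fld img by auto
    then show "\<exists>ws. set ws \<subseteq> W \<and> fold (press W F) ws d = {}" by blast
  qed
qed

lemma universally_solvable_class_iff:
  assumes "C \<in> unlabeled_graphs n e" "E \<in> C"
  shows "(\<forall>F\<in>C. universally_solvable {..<n} F) \<longleftrightarrow> universally_solvable {..<n} E"
proof -
  have "(E, F) \<in> iso_rel n e" if "F \<in> C" for F
    using assms that equiv_iso_rel[of n e] unfolding unlabeled_graphs_def
    by (meson quotient_eq_iff)
  then have "graph_iso {..<n} E {..<n} F" if "F \<in> C" for F
    using that by (auto simp: iso_rel_def)
  then show ?thesis using assms(2) universally_solvable_iso by blast
qed

end

theory Submission
  imports Defs "HOL-Combinatorics.Permutations"
begin

text \<open>
  The proof looks at the complement \<open>H\<close> of the graph, with \<open>k = N - e \<le> n div 2 + m\<close> edges, and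
  compares how the numerator and the denominator of \<open>P\<close> depend on \<open>k\<close>.

  Numerator: two isolated vertices of \<open>H\<close> are toggled by every press, so a solvable graph has a
  complement with at most one isolated vertex. This is impossible for \<open>k < n div 2\<close>, where \<open>P\<close>
  therefore vanishes. For \<open>n div 2 \<le> k \<le> n div 2 + m\<close> it forces \<open>H\<close> to consist of isolated edges
  apart from a part whose size depends on \<open>m\<close> only, so the number of solvable graphs is at most a
  constant \<open>c\<close> (\<open>card_solvable_classes_le\<close>). For \<open>k = n div 2\<close> there is at least one, the complement
  of a matching (\<open>universally_solvable_complement_matching\<close>).

  Denominator: for large \<open>n\<close> and \<open>k\<close> near \<open>n / 2\<close>, each further edge multiplies the number of unlabeled
  graphs with \<open>k\<close> edges by at least \<open>c\<close> (\<open>unlabeled_graphs_growth_rate\<close>). So \<open>P\<close> is at most the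
  reciprocal of the number of graphs at \<open>k = n div 2\<close> for every larger \<open>k\<close>, and at least this
  reciprocal at \<open>k = n div 2\<close>.

  By Burnside's lemma, the number of unlabeled graphs is the average, over all relabelings \<open>p\<close>, of the
  number of labeled graphs fixed by \<open>p\<close>. If \<open>p\<close> fixes many pairs of vertices, one can add a fixed pair
  as an edge, and double counting gives the growth of this term. If \<open>p\<close> fixes only \<open>O(k)\<close> pairs, a
  graph fixed by \<open>p\<close> is given by a set of fixed pairs and at most \<open>k / 2\<close> representatives of the
  other orbits, which leaves only \<open>n\<^bsup>k/2\<^esup>\<close> possibilities up to an exponential factor; this is
  negligible against the number of all graphs.
\<close>

section \<open>Subsets invariant under a map\<close>

definition invariant_subsets :: "('b \<Rightarrow> 'b) \<Rightarrow> 'b set \<Rightarrow> nat \<Rightarrow> 'b set set" where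
  "invariant_subsets \<tau> X k = {E. E \<subseteq> X \<and> card E = k \<and> \<tau> ` E = E}"

lemma finite_invariant_subsets: "finite X \<Longrightarrow> finite (invariant_subsets \<tau> X k)"
  by (rule finite_subset[of _ "Pow X"]) (auto simp: invariant_subsets_def)

lemma card_invariant_subsets_complement:
  assumes "finite X" "bij_betw \<tau> X X" "k \<le> card X"
  shows "card (invariant_subsets \<tau> X (card X - k)) = card (invariant_subsets \<tau> X k)"
proof -
  have *: "X - E \<in> invariant_subsets \<tau> X (card X - j)"
    if "E \<in> invariant_subsets \<tau> X j" for E j
  proof -
    have "E \<subseteq> X" "card E = j" "\<tau> ` E = E" using that by (auto simp: invariant_subsets_def)
    moreover from this have "\<tau> ` (X - E) = X - E"
      using assms(2) by (metis Diff_subset bij_betw_def inj_on_image_set_diff order_refl)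
    ultimately show ?thesis
      using assms(1) by (auto simp: invariant_subsets_def card_Diff_subset finite_subset)
  qed
  have "bij_betw (\<lambda>E. X - E) (invariant_subsets \<tau> X (card X - k)) (invariant_subsets \<tau> X k)"
  proof (rule bij_betw_byWitness[where f' = "\<lambda>E. X - E"])
    show "(\<lambda>E. X - E) ` invariant_subsets \<tau> X (card X - k) \<subseteq> invariant_subsets \<tau> X k"
      using *[of _ "card X - k"] assms(3) by auto
    show "(\<lambda>E. X - E) ` invariant_subsets \<tau> X k \<subseteq> invariant_subsets \<tau> X (card X - k)"
      using * by auto
  qed (auto simp: invariant_subsets_def)
  then show ?thesis by (rule bij_betw_same_card)
qed

text \<open>
  An invariant set stays invariant when a fixed point is added. With \<open>f\<close> fixed points, a \<open>k\<close>-set can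
  be extended in at least \<open>f - k\<close> ways, and a \<open>(k+1)\<close>-set arises in at most \<open>k + 1\<close> ways.
\<close>
lemma invariant_subsets_grow:
  assumes fin: "finite X" and many: "(C + 1) * (k + 1) \<le> card {x \<in> X. \<tau> x = x}"
  shows "C * card (invariant_subsets \<tau> X k) \<le> card (invariant_subsets \<tau> X (k + 1))"
proof -
  let ?I = "invariant_subsets \<tau> X" and ?F = "{x \<in> X. \<tau> x = x}"
  have "C * (k + 1) * card (?I k) = (\<Sum>E\<in>?I k. C * (k + 1))" by simp
  also have "\<dots> \<le> (\<Sum>E\<in>?I k. card (?F - E))"
  proof (rule sum_mono)
    fix E assume "E \<in> ?I k"
    then have "card E = k" "finite E" using fin
      by (auto simp: invariant_subsets_def intro: finite_subset)
    then have "card ?F - k \<le> card (?F - E)" using diff_card_le_card_Diff[of E ?F] by simp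
    then show "C * (k + 1) \<le> card (?F - E)" using many by (simp add: algebra_simps)
  qed
  also have "\<dots> = card (SIGMA E:?I k. ?F - E)"
    using finite_invariant_subsets[OF fin] fin by (simp add: card_SigmaI)
  also have "\<dots> \<le> card (SIGMA E:?I (k + 1). E)"
  proof (rule card_inj_on_le[where f = "\<lambda>(E, x). (insert x E, x)"])
    show "inj_on (\<lambda>(E, x). (insert x E, x)) (SIGMA E:?I k. ?F - E)"
      by (auto simp: inj_on_def dest: insert_ident)
    show "(\<lambda>(E, x). (insert x E, x)) ` (SIGMA E:?I k. ?F - E) \<subseteq> (SIGMA E:?I (k + 1). E)"
      using fin by (auto simp: invariant_subsets_def dest: finite_subset)
    show "finite (SIGMA E:?I (k + 1). E)"
      using fin finite_invariant_subsets[OF fin]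
      by (intro finite_SigmaI) (auto simp: invariant_subsets_def intro: finite_subset)
  qed
  also have "\<dots> = (\<Sum>E\<in>?I (k + 1). card E)"
    using fin finite_invariant_subsets[OF fin]
    by (intro card_SigmaI) (auto simp: invariant_subsets_def intro: finite_subset)
  also have "\<dots> = (k + 1) * card (?I (k + 1))"
    by (simp add: invariant_subsets_def)
  finally have "(k + 1) * (C * card (?I k)) \<le> (k + 1) * card (?I (k + 1))"
    by (simp add: algebra_simps)
  then show ?thesis by (subst (asm) mult_le_cancel1) simp
qed

definition forward_orbit :: "('b \<Rightarrow> 'b) \<Rightarrow> 'b \<Rightarrow> 'b set" where
  "forward_orbit \<tau> x = range (\<lambda>i. (\<tau> ^^ i) x)"

text \<open>
  One point from each orbit. On a finite set the map is a permutation, so forward iteration alone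
  exhausts an orbit.
\<close>
lemma orbit_representatives:
  assumes "finite E" "\<tau> ` E = E" "\<forall>x\<in>E. \<tau> x \<noteq> x"
  shows "\<exists>R\<subseteq>E. 2 * card R \<le> card E \<and> E = (\<Union>x\<in>R. forward_orbit \<tau> x)"
  using assms
proof (induction "card E" arbitrary: E rule: less_induct)
  case less
  show ?case
  proof (cases "E = {}")
    case False
    then obtain x where x: "x \<in> E" by blast
    let ?O = "forward_orbit \<tau> x"
    have inj: "inj_on \<tau> E" using less.prems(1,2) by (metis eq_card_imp_inj_on)
    have "(\<tau> ^^ i) x \<in> E" for i using x less.prems(2) by (induction i) auto
    then have O_sub: "?O \<subseteq> E" by (auto simp: forward_orbit_def)
    then have O_fin: "finite ?O" using less.prems(1) finite_subset by blast
    have "\<tau> ((\<tau> ^^ i) x) \<in> ?O" for i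
      unfolding forward_orbit_def by (rule range_eqI[of _ _ "Suc i"]) simp
    then have "\<tau> ` ?O \<subseteq> ?O" by (auto simp: forward_orbit_def)
    then have O_inv: "\<tau> ` ?O = ?O"
      using O_fin inj O_sub by (metis endo_inj_surj inj_on_subset)
    have mem: "x \<in> ?O" "\<tau> x \<in> ?O"
      unfolding forward_orbit_def by (auto intro: range_eqI[of _ _ 0] range_eqI[of _ _ 1])
    have "card {x, \<tau> x} = 2" using less.prems(3) x by (metis card_2_iff)
    then have O_card: "2 \<le> card ?O" using mem O_fin by (metis card_mono empty_subsetI insert_subset)
    have rest_inv: "\<tau> ` (E - ?O) = E - ?O"
      using inj O_sub O_inv less.prems(2) by (metis Diff_subset inj_on_image_set_diff order_refl)
    have rest_card: "card (E - ?O) = card E - card ?O" "card ?O \<le> card E"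
      using O_sub O_fin less.prems(1) by (auto simp: card_Diff_subset card_mono)
    then obtain R where R: "R \<subseteq> E - ?O" "2 * card R \<le> card (E - ?O)"
      "E - ?O = (\<Union>x\<in>R. forward_orbit \<tau> x)"
      using less.hyps[of "E - ?O"] less.prems rest_inv O_card by auto
    have "finite R" using R(1) less.prems(1) by (meson finite_Diff finite_subset)
    then have "2 * card (insert x R) \<le> card E"
      using R(2) rest_card O_card card_insert_le_m1 by (auto simp: card_insert_if)
    moreover have "E = (\<Union>x\<in>insert x R. forward_orbit \<tau> x)" using R(3) O_sub by auto
    moreover have "insert x R \<subseteq> E" using R(1) x by auto
    ultimately show ?thesis by blast
  qed auto
qed

text \<open>
  An invariant set is the union of its fixed points and of the orbits of its representatives, and
  every orbit without a fixed point has at least two elements.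
\<close>
lemma card_invariant_subsets_le:
  assumes fin: "finite X"
  shows "card (invariant_subsets \<tau> X k)
    \<le> 2 ^ card {x \<in> X. \<tau> x = x} * card {R. R \<subseteq> X \<and> 2 * card R \<le> k}"
proof -
  let ?F = "{x \<in> X. \<tau> x = x}" and ?R = "{R. R \<subseteq> X \<and> 2 * card R \<le> k}"
  let ?f = "\<lambda>(A, R). A \<union> (\<Union>x\<in>R. forward_orbit \<tau> x)"
  have "invariant_subsets \<tau> X k \<subseteq> ?f ` (Pow ?F \<times> ?R)"
  proof
    fix E assume "E \<in> invariant_subsets \<tau> X k"
    then have E: "E \<subseteq> X" "card E = k" "\<tau> ` E = E" "finite E"
      using fin by (auto simp: invariant_subsets_def intro: finite_subset)
    let ?E = "E - {x \<in> E. \<tau> x = x}"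
    have inj: "inj_on \<tau> E" using E(3,4) by (metis eq_card_imp_inj_on)
    have "\<tau> ` {x \<in> E. \<tau> x = x} = {x \<in> E. \<tau> x = x}" by force
    then have "\<tau> ` ?E = ?E"
      using inj_on_image_set_diff[OF inj, of E "{x \<in> E. \<tau> x = x}"] E(3) by auto
    then have "\<exists>R\<subseteq>?E. 2 * card R \<le> card ?E \<and> ?E = (\<Union>x\<in>R. forward_orbit \<tau> x)"
      by (intro orbit_representatives) (use E(4) in blast)+
    then obtain R where R: "R \<subseteq> ?E" "2 * card R \<le> card ?E"
      "?E = (\<Union>x\<in>R. forward_orbit \<tau> x)" by blast
    have "card ?E \<le> k" using E by (metis card_mono Diff_subset)
    then have "R \<in> ?R" using R E(1) by auto
    moreover have "E = ?f ({x \<in> E. \<tau> x = x}, R)" using R(3) by auto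
    moreover have "{x \<in> E. \<tau> x = x} \<in> Pow ?F" using E(1) by auto
    ultimately show "E \<in> ?f ` (Pow ?F \<times> ?R)" by blast
  qed
  moreover have "finite (Pow ?F \<times> ?R)" using fin by simp
  ultimately have "card (invariant_subsets \<tau> X k) \<le> card (Pow ?F \<times> ?R)"
    by (meson card_image_le card_mono finite_imageI le_trans)
  also have "\<dots> = 2 ^ card ?F * card ?R"
    using fin by (simp add: card_cartesian_product card_Pow)
  finally show ?thesis .
qed

text \<open>
  Each of these subsets \<open>R\<close> has weight \<open>n\<^bsup>k/2\<^esup> / n\<^bsup>|R|\<^esup> \<ge> 1\<close>, and the weights of all subsets of \<open>X\<close>
  add up to \<open>n\<^bsup>k/2\<^esup> (1 + 1/n)\<^bsup>|X|\<^esup>\<close>.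
\<close>
lemma card_small_subsets_le:
  fixes n :: nat
  assumes fin: "finite X" and "card X \<le> n ^ 2" and n: "n > 0"
  shows "real (card {R. R \<subseteq> X \<and> 2 * card R \<le> k}) \<le> exp (real n) * sqrt (real n) ^ k"
proof -
  let ?R = "{R. R \<subseteq> X \<and> 2 * card R \<le> k}"
  have "real (card ?R) = (\<Sum>R\<in>?R. 1)" by simp
  also have "\<dots> \<le> (\<Sum>R\<in>?R. sqrt n ^ k * (1 / n) ^ card R)"
  proof (rule sum_mono)
    fix R assume "R \<in> ?R"
    then have "real n ^ card R = sqrt n ^ (2 * card R)" using n by (simp add: power_mult)
    also have "\<dots> \<le> sqrt n ^ k" using \<open>R \<in> ?R\<close> n by (intro power_increasing) auto
    finally show "1 \<le> sqrt n ^ k * (1 / n) ^ card R" using n by (simp add: field_simps)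
  qed
  also have "\<dots> \<le> (\<Sum>R\<in>Pow X. sqrt n ^ k * (1 / n) ^ card R)"
    using fin by (intro sum_mono2) auto
  also have "\<dots> = sqrt n ^ k * (1 / n + 1) ^ card X"
    using prod_add[OF fin, of "\<lambda>_. 1 / real n" "\<lambda>_. 1"] by (simp add: sum_distrib_left)
  also have "(1 / real n + 1) ^ card X \<le> exp (1 / real n) ^ card X"
    using n by (intro power_mono) (auto simp: add.commute exp_ge_add_one_self)
  also have "\<dots> = exp (card X / n)" by (simp flip: exp_of_nat_mult)
  also have "\<dots> \<le> exp n"
  proof -
    have "real (card X) \<le> real (n ^ 2)" using assms(2) of_nat_le_iff by blast
    then show ?thesis using n by (simp add: field_simps power2_eq_square)
  qed
  finally show ?thesis using n by (simp add: mult.commute)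
qed

section \<open>Counting isomorphism classes\<close>

definition relabel :: "(nat \<Rightarrow> nat) \<Rightarrow> nat set set \<Rightarrow> nat set set" where
  "relabel p E = (`) p ` E"

lemma relabel_comp: "relabel p (relabel q E) = relabel (p \<circ> q) E"
  by (simp add: relabel_def image_image image_comp)

lemma relabel_id: "relabel id E = E"
  by (simp add: relabel_def)

lemma relabel_inv:
  assumes "p permutes S"
  shows "relabel (inv p) (relabel p E) = E" "relabel p (relabel (inv p) E) = E"
  using permutes_inv_o[OF assms] by (simp_all add: relabel_comp relabel_id)

lemma inj_image_permutes: "p permutes S \<Longrightarrow> inj ((`) p)"
  by (intro injI) (simp add: inj_image_eq_iff permutes_inj)

lemma card_relabel: "p permutes S \<Longrightarrow> card (relabel p E) = card E"
  unfolding relabel_def by (metis card_image inj_image_permutes inj_on_subset subset_UNIV)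

lemma relabel_nsets:
  assumes "p permutes {..<n}"
  shows "relabel p ([{..<n}]\<^bsup>2\<^esup>) = [{..<n}]\<^bsup>2\<^esup>"
proof -
  have sub: "relabel q ([{..<n}]\<^bsup>2\<^esup>) \<subseteq> [{..<n}]\<^bsup>2\<^esup>" if "q permutes {..<n}" for q
  proof
    fix e assume "e \<in> relabel q ([{..<n}]\<^bsup>2\<^esup>)"
    then obtain d where d: "e = q ` d" "d \<subseteq> {..<n}" "finite d" "card d = 2"
      by (auto simp: relabel_def nsets_def)
    have "e \<subseteq> {..<n}" using d(1,2) permutes_image[OF that] by blast
    moreover have "card e = 2" using d(1,4) card_image[OF permutes_inj_on[OF that]] by simp
    ultimately show "e \<in> [{..<n}]\<^bsup>2\<^esup>" using d(1,3) by (simp add: nsets_def)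
  qed
  have "relabel p (relabel (inv p) ([{..<n}]\<^bsup>2\<^esup>)) \<subseteq> relabel p ([{..<n}]\<^bsup>2\<^esup>)"
    unfolding relabel_def[of p] using sub[OF permutes_inv[OF assms]] by (rule image_mono)
  then show ?thesis using sub[OF assms] relabel_inv(2)[OF assms] by auto
qed

lemma relabel_subset:
  assumes "p permutes {..<n}" "E \<subseteq> [{..<n}]\<^bsup>2\<^esup>"
  shows "relabel p E \<subseteq> [{..<n}]\<^bsup>2\<^esup>"
  using image_mono[OF assms(2), of "(`) p"] relabel_nsets[OF assms(1)]
  by (simp add: relabel_def)

lemma relabel_complement:
  assumes "p permutes {..<n}"
  shows "relabel p ([{..<n}]\<^bsup>2\<^esup> - E) = [{..<n}]\<^bsup>2\<^esup> - relabel p E"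
  using relabel_nsets[OF assms] inj_image_permutes[OF assms]
  by (simp add: relabel_def image_set_diff)

lemma relabel_labeled_graphs:
  assumes "p permutes {..<n}" "E \<in> labeled_graphs n k"
  shows "relabel p E \<in> labeled_graphs n k"
  using assms relabel_subset card_relabel by (auto simp: labeled_graphs_def)

lemma graph_iso_iff_relabel:
  assumes E: "E \<subseteq> [{..<n}]\<^bsup>2\<^esup>" and F: "F \<subseteq> [{..<n}]\<^bsup>2\<^esup>"
  shows "graph_iso {..<n} E {..<n} F \<longleftrightarrow> (\<exists>p. p permutes {..<n} \<and> relabel p E = F)"
proof
  assume "graph_iso {..<n} E {..<n} F"
  then obtain f where f: "bij_betw f {..<n} {..<n}"
    "\<And>u v. u < n \<Longrightarrow> v < n \<Longrightarrow> {u, v} \<in> E \<longleftrightarrow> {f u, f v} \<in> F"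
    unfolding graph_iso_def by auto
  define p where "p = (\<lambda>x. if x \<in> {..<n} then f x else x)"
  have "bij_betw p {..<n} {..<n}"
    using f(1) by (subst bij_betw_cong[of _ _ f]) (auto simp: p_def)
  then have p: "p permutes {..<n}"
    by (rule bij_imp_permutes) (auto simp: p_def)
  have pf: "{u, v} \<in> E \<longleftrightarrow> p ` {u, v} \<in> F" if "u < n" "v < n" for u v
    using f(2) that by (simp add: p_def)
  have "relabel p E = F"
  proof
    show "relabel p E \<subseteq> F"
    proof
      fix e assume "e \<in> relabel p E"
      then obtain d where d: "d \<in> E" "e = p ` d" by (auto simp: relabel_def)
      moreover obtain u v where "d = {u, v}" "u < n" "v < n"
        using d(1) E nsets2_E by blast
      ultimately show "e \<in> F" using pf by blast
    qed
    show "F \<subseteq> relabel p E"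
    proof
      fix e assume "e \<in> F"
      then have "e \<in> relabel p ([{..<n}]\<^bsup>2\<^esup>)" using F relabel_nsets[OF p] by auto
      then obtain d where d: "d \<in> [{..<n}]\<^bsup>2\<^esup>" "e = p ` d" by (auto simp: relabel_def)
      moreover obtain u v where "d = {u, v}" "u < n" "v < n"
        using d(1) nsets2_E by blast
      ultimately show "e \<in> relabel p E" using pf \<open>e \<in> F\<close> unfolding relabel_def by blast
    qed
  qed
  then show "\<exists>p. p permutes {..<n} \<and> relabel p E = F" using p by blast
next
  assume "\<exists>p. p permutes {..<n} \<and> relabel p E = F"
  then obtain p where p: "p permutes {..<n}" "relabel p E = F" by blast
  have "{u, v} \<in> E \<longleftrightarrow> {p u, p v} \<in> F" for u v
    using inj_image_mem_iff[OF inj_image_permutes[OF p(1)], of "{u, v}" E] p(2)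
    by (simp add: relabel_def)
  then show "graph_iso {..<n} E {..<n} F"
    unfolding graph_iso_def using permutes_imp_bij[OF p(1)] by blast
qed

lemma iso_rel_iff:
  "(E, F) \<in> iso_rel n k \<longleftrightarrow>
    E \<in> labeled_graphs n k \<and> F \<in> labeled_graphs n k \<and> (\<exists>p. p permutes {..<n} \<and> relabel p E = F)"
  using graph_iso_iff_relabel by (auto simp: iso_rel_def labeled_graphs_def)

lemma finite_labeled_graphs: "finite (labeled_graphs n k)"
  by (rule finite_subset[of _ "Pow ([{..<n}]\<^bsup>2\<^esup>)"])
    (auto simp: labeled_graphs_def finite_imp_finite_nsets)

lemma finite_unlabeled_graphs: "finite (unlabeled_graphs n k)"
  unfolding unlabeled_graphs_def quotient_def using finite_labeled_graphs by simp

lemma card_nsets_2: "card ([{..<n::nat}]\<^bsup>2\<^esup>) = n choose 2"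
  by (simp only: binomial_eq_nsets atLeast0LessThan)

text \<open>
  Within one isomorphism class all automorphism groups have the same size, because the
  relabelings that carry a fixed graph \<open>D\<close> to a graph \<open>E\<close> form a coset of the automorphism group
  of \<open>E\<close>; these cosets partition the \<open>n!\<close> relabelings as \<open>E\<close> runs through the class of \<open>D\<close>.
\<close>
lemma sum_automorphisms_class:
  assumes "C \<in> unlabeled_graphs n k"
  shows "(\<Sum>E\<in>C. card {p. p permutes {..<n} \<and> relabel p E = E}) = fact n"
proof -
  obtain D where D: "D \<in> labeled_graphs n k" "C = iso_rel n k `` {D}"
    using assms unfolding unlabeled_graphs_def by (rule quotientE)
  have "C \<subseteq> labeled_graphs n k" unfolding D(2) by (auto simp: iso_rel_def)
  then have fin_C: "finite C" using finite_labeled_graphs finite_subset by blast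
  have memC: "E \<in> C \<longleftrightarrow> (\<exists>p. p permutes {..<n} \<and> relabel p D = E)" for E
    using D(1) relabel_labeled_graphs[OF _ D(1)] by (auto simp: D(2) iso_rel_iff)
  have fin: "finite {p. p permutes {..<n} \<and> Q p}" for Q
    by (rule finite_subset[of _ "{p. p permutes {..<n}}"]) (auto simp: finite_permutations)
  have "card {p. p permutes {..<n} \<and> relabel p E = E} = card {p. p permutes {..<n} \<and> relabel p D = E}"
    if E: "E \<in> C" for E
  proof -
    obtain q where q: "q permutes {..<n}" "relabel q D = E" using E memC by auto
    have qi: "relabel (inv q) E = D" using relabel_inv(1)[OF q(1), of D] q(2) by simp
    have "bij_betw (\<lambda>p. p \<circ> q) {p. p permutes {..<n} \<and> relabel p E = E}
      {p. p permutes {..<n} \<and> relabel p D = E}"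
    proof (rule bij_betw_byWitness[where f' = "\<lambda>p. p \<circ> inv q"])
      show "\<forall>p\<in>{p. p permutes {..<n} \<and> relabel p E = E}. p \<circ> q \<circ> inv q = p"
        using permutes_inv_o[OF q(1)] by (simp add: comp_assoc)
      show "\<forall>p\<in>{p. p permutes {..<n} \<and> relabel p D = E}. p \<circ> inv q \<circ> q = p"
        using permutes_inv_o[OF q(1)] by (simp add: comp_assoc)
      show "(\<lambda>p. p \<circ> q) ` {p. p permutes {..<n} \<and> relabel p E = E}
        \<subseteq> {p. p permutes {..<n} \<and> relabel p D = E}"
      proof -
        have "p \<circ> q permutes {..<n} \<and> relabel (p \<circ> q) D = E"
          if "p permutes {..<n}" "relabel p E = E" for p
          using that permutes_compose[OF q(1)] q(2) relabel_comp[of p q D] by simp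
        then show ?thesis by blast
      qed
      show "(\<lambda>p. p \<circ> inv q) ` {p. p permutes {..<n} \<and> relabel p D = E}
        \<subseteq> {p. p permutes {..<n} \<and> relabel p E = E}"
      proof -
        have "p \<circ> inv q permutes {..<n} \<and> relabel (p \<circ> inv q) E = E"
          if "p permutes {..<n}" "relabel p D = E" for p
          using that permutes_compose[OF permutes_inv[OF q(1)]] qi relabel_comp[of p "inv q" E]
          by simp
        then show ?thesis by blast
      qed
    qed
    then show ?thesis by (rule bij_betw_same_card)
  qed
  then have "(\<Sum>E\<in>C. card {p. p permutes {..<n} \<and> relabel p E = E})
      = (\<Sum>E\<in>C. card {p. p permutes {..<n} \<and> relabel p D = E})" by simp
  also have "\<dots> = card (\<Union>E\<in>C. {p. p permutes {..<n} \<and> relabel p D = E})"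
    by (subst card_UN_disjoint) (use fin_C fin in auto)
  also have "(\<Union>E\<in>C. {p. p permutes {..<n} \<and> relabel p D = E}) = {p. p permutes {..<n}}"
    using memC by blast
  also have "card \<dots> = fact n" by (simp add: card_permutations)
  finally show ?thesis .
qed

abbreviation fixed_graphs :: "nat \<Rightarrow> (nat \<Rightarrow> nat) \<Rightarrow> nat \<Rightarrow> nat set set set" where
  "fixed_graphs n p k \<equiv> invariant_subsets ((`) p) ([{..<n}]\<^bsup>2\<^esup>) k"

text \<open>Both sides count the pairs of a labeled graph and one of its automorphisms.\<close>
lemma burnside_unlabeled_graphs:
  "(\<Sum>p | p permutes {..<n}. card (fixed_graphs n p k)) = fact n * card (unlabeled_graphs n k)"
proof -
  let ?P = "{p. p permutes {..<n}}" and ?L = "labeled_graphs n k"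
  have finP: "finite ?P" by (simp add: finite_permutations)
  have "(\<Sum>p\<in>?P. card (fixed_graphs n p k)) = (\<Sum>p\<in>?P. card {E \<in> ?L. relabel p E = E})"
    by (intro sum.cong refl arg_cong[of _ _ card])
      (auto simp: invariant_subsets_def labeled_graphs_def relabel_def)
  also have "\<dots> = (\<Sum>E\<in>?L. card {p \<in> ?P. relabel p E = E})"
    using sum.swap_restrict[OF finP finite_labeled_graphs[of n k],
        of "\<lambda>_ _. 1::nat" "\<lambda>p E. relabel p E = E"] by simp
  also have "\<dots> = (\<Sum>C\<in>unlabeled_graphs n k. \<Sum>E\<in>C. card {p \<in> ?P. relabel p E = E})"
  proof -
    have un: "\<Union> (unlabeled_graphs n k) = ?L"
      unfolding unlabeled_graphs_def by (rule Union_quotient[OF equiv_iso_rel])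
    have disj: "\<forall>A\<in>unlabeled_graphs n k. \<forall>B\<in>unlabeled_graphs n k. A \<noteq> B \<longrightarrow> A \<inter> B = {}"
      unfolding unlabeled_graphs_def using quotient_disj[OF equiv_iso_rel] by blast
    have "finite A" if "A \<in> unlabeled_graphs n k" for A
      using that un finite_labeled_graphs by (metis Sup_upper finite_subset)
    then show ?thesis
      using sum.Union_disjoint[of "unlabeled_graphs n k"] disj unfolding un by simp
  qed
  also have "\<dots> = fact n * card (unlabeled_graphs n k)"
    using sum_automorphisms_class[of _ n k] by simp
  finally show ?thesis .
qed

lemma card_unlabeled_graphs_complement:
  assumes "k \<le> n choose 2"
  shows "card (unlabeled_graphs n ((n choose 2) - k)) = card (unlabeled_graphs n k)"
proof -
  let ?X = "[{..<n}]\<^bsup>2\<^esup>"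
  have "card (fixed_graphs n p (card ?X - k)) = card (fixed_graphs n p k)"
    if p: "p permutes {..<n}" for p
  proof (rule card_invariant_subsets_complement)
    show "bij_betw ((`) p) ?X ?X"
      using inj_image_permutes[OF p] relabel_nsets[OF p]
      by (auto simp: bij_betw_def relabel_def intro: inj_on_subset)
  qed (use assms in \<open>auto simp: card_nsets_2 finite_imp_finite_nsets\<close>)
  then have "fact n * card (unlabeled_graphs n ((n choose 2) - k)) = fact n * card (unlabeled_graphs n k)"
    by (simp flip: burnside_unlabeled_graphs add: card_nsets_2)
  then show ?thesis by simp
qed

section \<open>Growth of the number of sparse graphs\<close>

text \<open>
  Relabelings that fix the first \<open>v\<close> vertices leave every graph on these vertices unchanged, and
  they make up a proportion of at least \<open>1 / n\<^sup>v\<close> of all relabelings.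
\<close>
lemma card_unlabeled_graphs_ge:
  assumes "v \<le> n"
  shows "((v choose 2) choose k) \<le> n ^ v * card (unlabeled_graphs n k)"
proof -
  let ?Q = "{p. p permutes {v..<n}}" and ?w = "(v choose 2) choose k"
  have Q_sub: "?Q \<subseteq> {p. p permutes {..<n}}"
    by (auto intro: permutes_subset)
  have each: "?w \<le> card (fixed_graphs n p k)" if "p permutes {v..<n}" for p
  proof -
    have fixed: "p ` e = e" if "e \<subseteq> {..<v}" for e
    proof -
      have "p x = x" if "x \<in> e" for x
        using \<open>e \<subseteq> {..<v}\<close> that by (intro permutes_not_in[OF \<open>p permutes {v..<n}\<close>]) auto
      then show ?thesis by simp
    qed
    have "E \<in> fixed_graphs n p k" if "E \<subseteq> [{..<v}]\<^bsup>2\<^esup>" "card E = k" for E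
    proof -
      have "(`) p ` E = id ` E"
      proof (intro image_cong refl)
        fix e assume "e \<in> E"
        then have "e \<subseteq> {..<v}" using that(1) by (auto simp: nsets_def)
        then show "p ` e = id e" using fixed by simp
      qed
      then have "(`) p ` E = E" by simp
      moreover have "[{..<v}]\<^bsup>2\<^esup> \<subseteq> [{..<n}]\<^bsup>2\<^esup>" using assms by (intro nsets_mono) auto
      ultimately show ?thesis using that by (auto simp: invariant_subsets_def)
    qed
    then have "{E. E \<subseteq> [{..<v}]\<^bsup>2\<^esup> \<and> card E = k} \<subseteq> fixed_graphs n p k" by blast
    then have "card {E. E \<subseteq> [{..<v}]\<^bsup>2\<^esup> \<and> card E = k} \<le> card (fixed_graphs n p k)"
      by (intro card_mono finite_invariant_subsets) (auto simp: finite_imp_finite_nsets)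
    then show ?thesis
      by (simp add: n_subsets finite_imp_finite_nsets card_nsets_2)
  qed
  have "fact (n - v) * ?w = (\<Sum>p\<in>?Q. ?w)" by (simp add: card_permutations)
  also have "\<dots> \<le> (\<Sum>p\<in>?Q. card (fixed_graphs n p k))" using each by (intro sum_mono) auto
  also have "\<dots> \<le> (\<Sum>p | p permutes {..<n}. card (fixed_graphs n p k))"
    using Q_sub by (intro sum_mono2) (auto simp: finite_permutations)
  also have "\<dots> = fact n * card (unlabeled_graphs n k)" by (rule burnside_unlabeled_graphs)
  also have "(fact n :: nat) \<le> n ^ v * fact (n - v)"
  proof -
    have "(fact (n - v) :: nat) dvd fact n" by (intro fact_dvd) simp
    then have "(fact n :: nat) = fact n div fact (n - v) * fact (n - v)" by simp
    also have "\<dots> \<le> n ^ v * fact (n - v)"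
      using fact_div_fact_le_pow[OF assms] by (intro mult_right_mono) auto
    finally show ?thesis .
  qed
  finally have "fact (n - v) * ?w \<le> fact (n - v) * (n ^ v * card (unlabeled_graphs n k))"
    by (simp add: algebra_simps)
  then show ?thesis by (subst (asm) mult_le_cancel1) simp
qed

text \<open>
  In Burnside's sum, the terms of relabelings with many fixed pairs grow by a factor of \<open>C\<close>
  when an edge is added, and the other terms are bounded by \<open>T\<close>.
\<close>
lemma unlabeled_graphs_grow:
  fixes T :: real
  assumes rigid: "\<And>p. p permutes {..<n} \<Longrightarrow>
      card {e \<in> [{..<n}]\<^bsup>2\<^esup>. p ` e = e} < (C + 1) * (k + 1) \<Longrightarrow> card (fixed_graphs n p k) \<le> T"
    and T: "T \<ge> 0"
  shows "C * (card (unlabeled_graphs n k) - T) \<le> card (unlabeled_graphs n (k + 1))"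
proof -
  let ?P = "{p. p permutes {..<n}}"
  let ?f = "\<lambda>k p. real (card (fixed_graphs n p k))"
  have burnside: "(\<Sum>p\<in>?P. ?f j p) = fact n * real (card (unlabeled_graphs n j))" for j
    using arg_cong[OF burnside_unlabeled_graphs[of n j], of real] by simp
  have each: "C * ?f k p \<le> ?f (k + 1) p + C * T" if "p permutes {..<n}" for p
  proof (cases "card {e \<in> [{..<n}]\<^bsup>2\<^esup>. p ` e = e} < (C + 1) * (k + 1)")
    case True
    then have "C * ?f k p \<le> C * T" using rigid[OF that] by (simp add: mult_left_mono)
    then show ?thesis by (simp add: add_increasing)
  next
    case False
    then have "C * card (fixed_graphs n p k) \<le> card (fixed_graphs n p (k + 1))"
      by (intro invariant_subsets_grow) (auto simp: finite_imp_finite_nsets)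
    then have "C * ?f k p \<le> ?f (k + 1) p" by (metis of_nat_le_iff of_nat_mult)
    then show ?thesis using T by (simp add: add_increasing2)
  qed
  have "fact n * (real C * card (unlabeled_graphs n k)) = C * (\<Sum>p\<in>?P. ?f k p)"
    unfolding burnside by simp
  also have "\<dots> = (\<Sum>p\<in>?P. C * ?f k p)" by (rule sum_distrib_left)
  also have "\<dots> \<le> (\<Sum>p\<in>?P. ?f (k + 1) p + C * T)" using each by (intro sum_mono) auto
  also have "\<dots> = fact n * (card (unlabeled_graphs n (k + 1)) + C * T)"
    unfolding sum.distrib burnside by (simp add: card_permutations algebra_simps)
  finally have "real C * card (unlabeled_graphs n k) \<le> card (unlabeled_graphs n (k + 1)) + C * T"
    by (subst (asm) mult_le_cancel_left_pos) auto
  then show ?thesis by (simp add: algebra_simps)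
qed

lemma choose_two_le_square: "n choose 2 \<le> n ^ 2" for n :: nat
proof -
  have "n * (n - 1) div 2 \<le> n * (n - 1)" by (rule div_le_dividend)
  also have "\<dots> \<le> n ^ 2" by (simp add: power2_eq_square)
  finally show ?thesis by (simp add: choose_two)
qed

lemma card_fixed_graphs_le:
  assumes n: "n > 0" and kn: "k \<le> n"
    and few: "card {e \<in> [{..<n}]\<^bsup>2\<^esup>. p ` e = e} < (C + 1) * (k + 1)"
  shows "card (fixed_graphs n p k) \<le> (2 ^ (2 * (C + 1)) * exp 1) ^ n * sqrt n ^ k"
proof -
  let ?X = "[{..<n}]\<^bsup>2\<^esup>"
  let ?F = "card {e \<in> ?X. p ` e = e}"
  have fin: "finite ?X" by (simp add: finite_imp_finite_nsets)
  have "card ?X \<le> n ^ 2" unfolding card_nsets_2 by (rule choose_two_le_square)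
  have "(C + 1) * (k + 1) \<le> (C + 1) * (2 * n)" using n kn by (intro mult_left_mono) auto
  then have F: "?F \<le> 2 * (C + 1) * n" using few by (simp add: algebra_simps)
  have "real (card (fixed_graphs n p k))
      \<le> real (2 ^ ?F * card {R. R \<subseteq> ?X \<and> 2 * card R \<le> k})"
    using card_invariant_subsets_le[OF fin, of "(`) p" k] by (rule of_nat_mono)
  also have "\<dots> = 2 ^ ?F * real (card {R. R \<subseteq> ?X \<and> 2 * card R \<le> k})" by simp
  also have "\<dots> \<le> 2 ^ (2 * (C + 1) * n) * (exp n * sqrt n ^ k)"
    using F card_small_subsets_le[OF fin \<open>card ?X \<le> n ^ 2\<close> n, of k]
    by (intro mult_mono power_increasing) auto
  also have "\<dots> = (2 ^ (2 * (C + 1)) * exp 1) ^ n * sqrt n ^ k"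
    using exp_of_nat_mult[of n "1::real"]
    by (simp only: power_mult power_mult_distrib mult_1_right mult.assoc)
  finally show ?thesis .
qed

text \<open>
  Already the graphs on the first \<open>n div 12\<close> vertices outnumber the bound for relabelings
  with few fixed pairs: up to factors exponential in \<open>n\<close>, the former number at least \<open>n\<^bsup>k - n/12\<^esup>\<close> and
  the latter is \<open>n\<^bsup>k/2\<^esup>\<close>, while \<open>k/2 \<ge> n/6\<close>.
\<close>
lemma card_unlabeled_graphs_superexponential:
  fixes D :: real
  assumes D: "D \<ge> 1" and n: "(4608 * D) ^ 12 \<le> n" and kn: "n \<le> 3 * k" "k \<le> n"
  shows "2 * (D ^ n * sqrt n ^ k) \<le> card (unlabeled_graphs n k)"
proof -
  \<comment> \<open>Since \<open>v \<ge> n / 24\<close>, there are \<open>w \<ge> v\<^sup>2 / 4 \<ge> n\<^sup>2 / 2304\<close> pairs, and \<open>4608 = 2 \<cdot> 2304\<close>.\<close>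
  define v w where "v = n div 12" and "w = v choose 2"
  let ?Q = "4608 * D" and ?g = "real (card (unlabeled_graphs n k))"
  have "4608 \<le> (4608::real) ^ 12" by simp
  also have "\<dots> \<le> ?Q ^ 12" using D by (intro power_mono) auto
  finally have n_large: "n \<ge> 4608" using n by linarith
  have v: "12 * v \<le> n" "n \<le> 24 * v" "2 \<le> v" using n_large by (auto simp: v_def)
  have w: "real n * n \<le> 2304 * w"
  proof -
    have "even (v * (v - 1))" by auto
    then have "2 * w = v * (v - 1)" unfolding w_def choose_two by simp
    moreover have "v * v \<le> v * (2 * (v - 1))" using v(3) by (intro mult_left_mono) auto
    ultimately have "v * v \<le> 4 * w" by (simp only: mult.left_commute[of v 2])
    moreover have "n * n \<le> (24 * v) * (24 * v)" using v(2) by (intro mult_mono) auto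
    ultimately have "n * n \<le> 2304 * w" by linarith
    then show ?thesis by (metis of_nat_le_iff of_nat_mult of_nat_numeral)
  qed
  have k_pos: "k > 0" using kn n_large by linarith
  have "real n * k \<le> real n * n" using kn by (intro mult_left_mono) auto
  then have nk: "real n * k \<le> 2304 * w" using w by linarith
  then have wk: "n / 2304 \<le> w / k" using k_pos by (simp add: field_simps)
  have "2304 * real k \<le> real n * k" using n_large by (intro mult_right_mono) auto
  then have kw: "k \<le> w" using nk by linarith
  have "(n / 2304) ^ k \<le> (w / k) ^ k" using wk by (intro power_mono) auto
  also have "\<dots> \<le> w choose k" using kw by (rule binomial_ge_n_over_k_pow_k)
  also have "\<dots> \<le> real (n ^ v * card (unlabeled_graphs n k))"
    unfolding w_def using card_unlabeled_graphs_ge[of v n k] v(1) by (intro of_nat_mono) simp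
  finally have lower: "(n / 2304) ^ k \<le> real n ^ v * ?g" by simp
  have "2 * D ^ n * 2304 ^ k * real n ^ v \<le> 2 ^ n * D ^ n * 2304 ^ n * real n ^ v"
  proof -
    have "(2::real) ^ 1 \<le> 2 ^ n" using n_large by (intro power_increasing) auto
    moreover have "(2304::real) ^ k \<le> 2304 ^ n" using kn by (intro power_increasing) auto
    ultimately show ?thesis using D by (intro mult_mono) auto
  qed
  also have "\<dots> = (2 * D * 2304) ^ n * real n ^ v" by (simp only: power_mult_distrib)
  also have "2 * D * 2304 = ?Q" by simp
  also have "?Q ^ n * real n ^ v \<le> sqrt n ^ k"
  proof -
    have "(a ^ n * b ^ v) ^ 12 = (a ^ 12) ^ n * b ^ (12 * v)" for a b :: real
      by (simp add: power_mult_distrib power_mult[symmetric] mult.commute)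
    then have "(?Q ^ n * real n ^ v) ^ 12 = (?Q ^ 12) ^ n * real n ^ (12 * v)" .
    also have "\<dots> \<le> real n ^ n * real n ^ n"
      using n v(1) n_large D by (intro mult_mono power_mono power_increasing) auto
    also have "\<dots> = real n ^ (2 * n)" by (simp add: power_add[symmetric] mult_2)
    also have "\<dots> \<le> real n ^ (6 * k)" using kn n_large by (intro power_increasing) auto
    also have "\<dots> = (sqrt n ^ 2) ^ (6 * k)" by simp
    also have "\<dots> = (sqrt n ^ k) ^ 12" by (simp only: power_mult[symmetric]) (simp add: mult.commute)
    finally show ?thesis by (subst (asm) power_mono_iff) (use D in auto)
  qed
  finally have *: "2 * D ^ n * 2304 ^ k * real n ^ v \<le> sqrt n ^ k" .
  have "2 * (D ^ n * sqrt n ^ k) * (2304 ^ k * real n ^ v)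
      = sqrt n ^ k * (2 * D ^ n * 2304 ^ k * real n ^ v)" by (simp add: algebra_simps)
  also have "\<dots> \<le> sqrt n ^ k * sqrt n ^ k" using * by (intro mult_left_mono) auto
  also have "\<dots> = 2304 ^ k * (n / 2304) ^ k" by (simp flip: power_mult_distrib)
  also have "\<dots> \<le> 2304 ^ k * (real n ^ v * ?g)" using lower by (intro mult_left_mono) auto
  finally have "2 * (D ^ n * sqrt n ^ k) * (2304 ^ k * real n ^ v) \<le> ?g * (2304 ^ k * real n ^ v)"
    by (simp add: algebra_simps)
  then show ?thesis using n_large by (subst (asm) mult_le_cancel_right_pos) auto
qed

text \<open>
  The bound for relabelings with few fixed pairs is at most half of the number of graphs. So the
  other relabelings, taken with growth factor \<open>2 C\<close>, still give the factor \<open>C\<close>.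
\<close>
lemma unlabeled_graphs_growth_rate:
  fixes C :: nat
  obtains M where "\<And>n k. M \<le> n \<Longrightarrow> n \<le> 3 * k \<Longrightarrow> k \<le> n \<Longrightarrow>
    C * card (unlabeled_graphs n k) \<le> card (unlabeled_graphs n (k + 1))"
proof
  fix n k :: nat
  define D :: real where "D = 2 ^ (2 * (2 * C + 1)) * exp 1"
  let ?T = "D ^ n * sqrt n ^ k"
  assume n: "nat \<lceil>(4608 * D) ^ 12\<rceil> + 1 \<le> n" and kn: "n \<le> 3 * k" "k \<le> n"
  have "1 * 1 \<le> 2 ^ (2 * (2 * C + 1)) * exp (1::real)" by (intro mult_mono one_le_power) auto
  then have D: "D \<ge> 1" unfolding D_def by (simp only: mult_1)
  have "2 * ?T \<le> card (unlabeled_graphs n k)"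
    using n kn D by (intro card_unlabeled_graphs_superexponential) linarith+
  moreover have "(2 * C) * (card (unlabeled_graphs n k) - ?T) \<le> card (unlabeled_graphs n (k + 1))"
  proof (rule unlabeled_graphs_grow)
    show "card (fixed_graphs n p k) \<le> ?T"
      if "card {e \<in> [{..<n}]\<^bsup>2\<^esup>. p ` e = e} < (2 * C + 1) * (k + 1)" for p
      unfolding D_def using n kn(2) that by (intro card_fixed_graphs_le) auto
    show "0 \<le> ?T" using D by simp
  qed
  moreover have "C * (2 * ?T) \<le> C * real (card (unlabeled_graphs n k))"
    using calculation(1) by (intro mult_left_mono) auto
  ultimately have "real (C * card (unlabeled_graphs n k)) \<le> card (unlabeled_graphs n (k + 1))"
    by (simp add: algebra_simps)
  then show "C * card (unlabeled_graphs n k) \<le> card (unlabeled_graphs n (k + 1))" by linarith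
qed

section \<open>Sparse graphs with at most one isolated vertex\<close>

definition at_most_one_isolated :: "nat \<Rightarrow> nat set set \<Rightarrow> bool" where
  "at_most_one_isolated n H \<longleftrightarrow> (\<forall>x<n. \<forall>y<n. x \<notin> \<Union>H \<longrightarrow> y \<notin> \<Union>H \<longrightarrow> x = y)"

lemma card_nonisolated_ge:
  assumes "at_most_one_isolated n H" "H \<in> labeled_graphs n k"
  shows "n \<le> card (\<Union>H) + 1"
proof -
  have sub: "\<Union>H \<subseteq> {..<n}" using assms(2) by (auto simp: labeled_graphs_def nsets_def)
  have "card ({..<n} - \<Union>H) \<le> Suc 0"
    using assms(1) by (subst card_le_Suc0_iff_eq) (auto simp: at_most_one_isolated_def)
  moreover have "card ({..<n} - \<Union>H) = n - card (\<Union>H)"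
    using sub by (subst card_Diff_subset) (auto intro: finite_subset)
  ultimately show ?thesis by linarith
qed

lemma at_most_one_isolated_imp_le:
  assumes "at_most_one_isolated n H" "H \<in> labeled_graphs n k"
  shows "n \<le> 2 * k + 1"
proof -
  have "card (\<Union>H) \<le> (\<Sum>e\<in>H. card e)"
    using card_Union_le_sum_card .
  also have "\<dots> = (\<Sum>e\<in>H. 2)"
    using assms(2) by (intro sum.cong) (auto simp: labeled_graphs_def nsets_def)
  also have "\<dots> = 2 * k" using assms(2) by (simp add: labeled_graphs_def)
  finally show ?thesis using card_nonisolated_ge[OF assms] by linarith
qed

lemma at_most_one_isolated_relabel:
  assumes p: "p permutes {..<n}" and H: "at_most_one_isolated n H"
  shows "at_most_one_isolated n (relabel p H)"
  unfolding at_most_one_isolated_def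
proof (intro allI impI)
  fix x y assume xy: "x < n" "y < n" "x \<notin> \<Union>(relabel p H)" "y \<notin> \<Union>(relabel p H)"
  have *: "inv p z < n \<and> inv p z \<notin> \<Union>H" if "z < n" "z \<notin> \<Union>(relabel p H)" for z
  proof -
    have "inv p z \<in> {..<n}" using permutes_in_image[OF permutes_inv[OF p], of z] that(1) by simp
    moreover have "p (inv p z) = z" using p by (simp add: permutes_inverses)
    ultimately show ?thesis using that(2) unfolding relabel_def by force
  qed
  have "inv p x = inv p y" using *[OF xy(1,3)] *[OF xy(2,4)] H by (auto simp: at_most_one_isolated_def)
  then show "x = y" using p by (metis permutes_inverses(1))
qed

text \<open>
  All vertices but at most one have degree at least one, and the degrees add up to \<open>2 k \<le> n + 2 m\<close>,
  so at most \<open>2 m + 1\<close> vertices have degree two or more. If every edge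
  contained such a vertex, then each edge would contribute at most one further vertex, and
  the edges could not cover all vertices but one.
\<close>
lemma isolated_edge_exists:
  assumes amoi: "at_most_one_isolated n H" and H: "H \<in> labeled_graphs n k"
    and k: "2 * k \<le> n + 2 * m" and n: "6 * m + 5 \<le> n"
  shows "\<exists>a b. {a, b} \<in> H \<and> a \<noteq> b \<and> (\<forall>e\<in>H. a \<in> e \<or> b \<in> e \<longrightarrow> e = {a, b})"
proof (rule ccontr)
  assume none: "\<not> ?thesis"
  define deg where "deg x = card {e \<in> H. x \<in> e}" for x
  define A where "A = {x \<in> {..<n}. 2 \<le> deg x}"
  have H_sub: "H \<subseteq> [{..<n}]\<^bsup>2\<^esup>" and H_card: "card H = k" using H by (auto simp: labeled_graphs_def)
  have H_fin: "finite H" using H_sub finite_imp_finite_nsets finite_subset by blast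
  have U_sub: "\<Union>H \<subseteq> {..<n}" using H_sub by (auto simp: nsets_def)
  then have U_fin: "finite (\<Union>H)" using finite_subset by blast
  have A_sub: "A \<subseteq> \<Union>H"
  proof
    fix x assume "x \<in> A"
    then have "{e \<in> H. x \<in> e} \<noteq> {}" by (metis A_def card.empty deg_def mem_Collect_eq not_numeral_le_zero)
    then show "x \<in> \<Union>H" by auto
  qed
  have A_fin: "finite A" by (simp add: A_def)
  have "(\<Sum>x\<in>{..<n}. deg x) = (\<Sum>e\<in>H. card {x \<in> {..<n}. x \<in> e})"
    using sum.swap_restrict[OF finite_lessThan[of n] H_fin, of "\<lambda>_ _. 1::nat" "\<lambda>x e. x \<in> e"]
    by (simp add: deg_def)
  also have "\<dots> = (\<Sum>e\<in>H. 2)"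
  proof (rule sum.cong)
    fix e assume "e \<in> H"
    then have "e \<subseteq> {..<n}" "card e = 2" using H_sub by (auto simp: nsets_def)
    moreover from this have "{x \<in> {..<n}. x \<in> e} = e" by auto
    ultimately show "card {x \<in> {..<n}. x \<in> e} = 2" by simp
  qed simp
  finally have handshake: "(\<Sum>x\<in>{..<n}. deg x) = 2 * k" using H_card by simp
  have "card (\<Union>H) + card A = (\<Sum>x\<in>\<Union>H. 1) + (\<Sum>x\<in>\<Union>H. if x \<in> A then 1 else 0)"
    using U_fin A_sub by (simp add: sum.If_cases Int_absorb1 Int_def[symmetric])
  also have "\<dots> = (\<Sum>x\<in>\<Union>H. 1 + (if x \<in> A then 1 else 0))" by (simp only: sum.distrib)
  also have "\<dots> \<le> (\<Sum>x\<in>\<Union>H. deg x)"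
  proof (rule sum_mono)
    fix x assume "x \<in> \<Union>H"
    then have "{e \<in> H. x \<in> e} \<noteq> {}" by auto
    then have "deg x \<ge> 1" unfolding deg_def using H_fin by (simp add: Suc_leI card_gt_0_iff)
    then show "1 + (if x \<in> A then 1 else 0) \<le> deg x" by (auto simp: A_def)
  qed
  also have "\<dots> \<le> (\<Sum>x\<in>{..<n}. deg x)" using U_sub by (intro sum_mono2) auto
  finally have few_branching: "card (\<Union>H) + card A \<le> 2 * k" using handshake by simp
  have meets: "card (e - A) \<le> 1" if e: "e \<in> H" for e
  proof -
    obtain a b where ab: "e = {a, b}" "a \<noteq> b" "a < n" "b < n" using e H_sub nsets2_E by blast
    have "a \<in> A \<or> b \<in> A"
    proof (rule ccontr)
      assume "\<not> (a \<in> A \<or> b \<in> A)"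
      then have "deg a \<le> Suc 0" "deg b \<le> Suc 0" using ab by (auto simp: A_def)
      then have "d = e" if "d \<in> H" "a \<in> d \<or> b \<in> d" for d
        using that e ab(1) H_fin by (auto simp: deg_def card_le_Suc0_iff_eq)
      then show False using none e ab by blast
    qed
    then have "e - A \<subseteq> {a} \<or> e - A \<subseteq> {b}" using ab by auto
    then show ?thesis by (metis card_mono card.empty card_insert_disjoint empty_iff finite.emptyI finite.insertI One_nat_def)
  qed
  have "card (\<Union>H) \<le> card A + card (\<Union>H - A)"
    using A_sub A_fin by (simp add: card_Diff_subset)
  also have "card (\<Union>H - A) = card (\<Union>e\<in>H. e - A)" by (rule arg_cong[of _ _ card]) auto
  also have "\<dots> \<le> (\<Sum>e\<in>H. card (e - A))" using H_fin by (rule card_UN_le)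
  also have "\<dots> \<le> (\<Sum>e\<in>H. 1)" using meets by (rule sum_mono)
  finally have "card (\<Union>H) \<le> card A + k" using H_card by simp
  then show False
    using few_branching card_nonisolated_ge[OF amoi H] k n by linarith
qed

lemma relabel_isolated_edge_last:
  assumes amoi: "at_most_one_isolated (n + 2) H" and H: "H \<in> labeled_graphs (n + 2) (k + 1)"
    and ab: "{a, b} \<in> H" "a \<noteq> b" and isolated: "\<And>e. e \<in> H \<Longrightarrow> a \<in> e \<or> b \<in> e \<Longrightarrow> e = {a, b}"
  shows "\<exists>p F. p permutes {..<n + 2} \<and> F \<in> labeled_graphs n k \<and> at_most_one_isolated n F \<and>
    relabel p H = insert {n, n + 1} F"
proof -
  define q where "q = Transposition.transpose a n"
  define p where "p = Transposition.transpose (q b) (n + 1) \<circ> q"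
  have abn: "a < n + 2" "b < n + 2" using ab(1) H by (auto simp: labeled_graphs_def)
  then have qb: "q b \<noteq> n" "q b < n + 2" using ab(2)
    by (auto simp: p_def q_def transpose_def)
  have p: "p permutes {..<n + 2}"
    unfolding p_def q_def using abn qb(2)[unfolded q_def] by (intro permutes_compose permutes_swap_id) auto
  have p_ab: "p a = n" "p b = n + 1" using qb(1) by (auto simp: p_def q_def transpose_def)
  define F where "F = relabel p H - {{n, n + 1}}"
  have relH: "relabel p H \<in> labeled_graphs (n + 2) (k + 1)" using p H by (rule relabel_labeled_graphs)
  have mem: "{n, n + 1} \<in> relabel p H"
    unfolding relabel_def using ab(1) p_ab by (intro image_eqI[of _ _ "{a, b}"]) auto
  have last_isolated: "e = {n, n + 1}" if e: "e \<in> relabel p H" "n \<in> e \<or> n + 1 \<in> e" for e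
  proof -
    obtain d where d: "d \<in> H" "e = p ` d" using e(1) unfolding relabel_def by blast
    have "a \<in> d \<or> b \<in> d"
      using e(2) d(2) p_ab inj_image_mem_iff[OF permutes_inj[OF p]] by metis
    then have "d = {a, b}" using isolated d(1) by blast
    then show ?thesis using d(2) p_ab by auto
  qed
  have "F \<subseteq> [{..<n}]\<^bsup>2\<^esup>"
  proof
    fix e assume e: "e \<in> F"
    then have "e \<subseteq> {..<n + 2}" "finite e" "card e = 2"
      using relH by (auto simp: F_def labeled_graphs_def nsets_def)
    moreover have "n \<notin> e" "n + 1 \<notin> e" using last_isolated[of e] e by (auto simp: F_def)
    ultimately show "e \<in> [{..<n}]\<^bsup>2\<^esup>" by (fastforce simp: nsets_def less_Suc_eq)
  qed
  moreover have "card F = k" using relH mem by (simp add: F_def labeled_graphs_def)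
  ultimately have "F \<in> labeled_graphs n k" by (simp add: labeled_graphs_def)
  moreover have "relabel p H = insert {n, n + 1} F" using mem by (auto simp: F_def)
  moreover have "at_most_one_isolated n F"
    unfolding at_most_one_isolated_def
  proof (intro allI impI)
    fix x y assume xy: "x < n" "y < n" "x \<notin> \<Union>F" "y \<notin> \<Union>F"
    then have "x \<notin> \<Union>(relabel p H)" "y \<notin> \<Union>(relabel p H)"
      unfolding \<open>relabel p H = insert {n, n + 1} F\<close> by auto
    then show "x = y"
      using at_most_one_isolated_relabel[OF p amoi] xy(1,2) by (simp add: at_most_one_isolated_def)
  qed
  ultimately show ?thesis using p by blast
qed

text \<open>
  Removing isolated edges one after another leaves a graph with fewer than \<open>6 m + 5\<close> vertices, and
  this core determines the graph up to isomorphism. So the number of these graphs is bounded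
  independently of \<open>n\<close>.
\<close>
lemma bounded_representatives:
  assumes "2 * k \<le> n + 2 * m"
  shows "\<exists>R\<subseteq>labeled_graphs n k. card R \<le> 2 ^ (6 * m + 5)\<^sup>2 \<and>
    (\<forall>H\<in>labeled_graphs n k. at_most_one_isolated n H \<longrightarrow>
      (\<exists>p. p permutes {..<n} \<and> relabel p H \<in> R))"
  using assms
proof (induction n arbitrary: k rule: less_induct)
  case (less n)
  show ?case
  proof (cases "n < 6 * m + 5")
    case True
    have "card (labeled_graphs n k) \<le> card (Pow ([{..<n}]\<^bsup>2\<^esup>))"
      by (rule card_mono) (auto simp: labeled_graphs_def finite_imp_finite_nsets)
    also have "\<dots> = 2 ^ (n choose 2)" by (simp add: card_Pow finite_imp_finite_nsets card_nsets_2)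
    also have "\<dots> \<le> 2 ^ (6 * m + 5)\<^sup>2"
    proof (rule power_increasing)
      have "n\<^sup>2 \<le> (6 * m + 5)\<^sup>2" using True by (intro power_mono) auto
      then show "n choose 2 \<le> (6 * m + 5)\<^sup>2" using choose_two_le_square[of n] by linarith
    qed simp
    finally have "card (labeled_graphs n k) \<le> 2 ^ (6 * m + 5)\<^sup>2" .
    moreover have "\<exists>p. p permutes {..<n} \<and> relabel p H \<in> labeled_graphs n k"
      if "H \<in> labeled_graphs n k" for H
      using that permutes_id relabel_id by metis
    ultimately show ?thesis by blast
  next
    case False
    define n' where "n' = n - 2"
    have n: "n = n' + 2" using False by (simp add: n'_def)
    show ?thesis
    proof (cases k)
      case 0
      have "\<not> at_most_one_isolated n H" if "H \<in> labeled_graphs n k" for H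
        using at_most_one_isolated_imp_le[OF _ that] False 0 by auto
      then show ?thesis by (intro exI[of _ "{}"]) auto
    next
      case (Suc k')
      then have k: "k = k' + 1" by simp
      have "2 * k' \<le> n' + 2 * m" using less.prems k n by simp
      then obtain R' where R': "R' \<subseteq> labeled_graphs n' k'" "card R' \<le> 2 ^ (6 * m + 5)\<^sup>2"
        "\<And>H. H \<in> labeled_graphs n' k' \<Longrightarrow> at_most_one_isolated n' H \<Longrightarrow>
          \<exists>p. p permutes {..<n'} \<and> relabel p H \<in> R'"
        using less.IH[of n' k'] n by auto
      \<comment> \<open>Removing an isolated edge lowers \<open>2 k\<close> and \<open>n\<close> both by two, so \<open>m\<close> stays the same.\<close>
      define R where "R = insert {n', n' + 1} ` R'"
      have "finite R'" using R'(1) finite_labeled_graphs finite_subset by blast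
      then have "card R \<le> 2 ^ (6 * m + 5)\<^sup>2"
        using R'(2) card_image_le[of R' "insert {n', n' + 1}"] by (simp add: R_def)
      moreover have "R \<subseteq> labeled_graphs n k"
      proof
        fix r assume "r \<in> R"
        then obtain F where F: "r = insert {n', n' + 1} F" "F \<subseteq> [{..<n'}]\<^bsup>2\<^esup>" "card F = k'"
          using R'(1) by (auto simp: R_def labeled_graphs_def)
        have "finite F" using F(2) finite_imp_finite_nsets finite_subset by blast
        moreover have "{n', n' + 1} \<notin> F" using F(2) by auto
        moreover have "[{..<n'}]\<^bsup>2\<^esup> \<subseteq> [{..<n}]\<^bsup>2\<^esup>" using n by (intro nsets_mono) auto
        ultimately show "r \<in> labeled_graphs n k" using F k n by (auto simp: labeled_graphs_def)
      qed
      moreover have "\<exists>p. p permutes {..<n} \<and> relabel p H \<in> R"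
        if H: "H \<in> labeled_graphs n k" and amoi: "at_most_one_isolated n H" for H
      proof -
        obtain a b where "{a, b} \<in> H" "a \<noteq> b" "\<And>e. e \<in> H \<Longrightarrow> a \<in> e \<or> b \<in> e \<Longrightarrow> e = {a, b}"
          using isolated_edge_exists[OF amoi H less.prems] False by (meson not_less)
        then obtain p F where p: "p permutes {..<n}" and F: "F \<in> labeled_graphs n' k'"
          "at_most_one_isolated n' F" "relabel p H = insert {n', n' + 1} F"
          using relabel_isolated_edge_last[of n' H k' a b] amoi H unfolding n k by blast
        obtain q where q: "q permutes {..<n'}" "relabel q F \<in> R'" using R'(3) F by blast
        have "q n' = n'" "q (n' + 1) = n' + 1" using permutes_not_in[OF q(1)] by auto
        then have "relabel (q \<circ> p) H = insert {n', n' + 1} (relabel q F)"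
          unfolding relabel_comp[symmetric] F(3) by (simp add: relabel_def)
        then have "relabel (q \<circ> p) H \<in> R" using q(2) by (simp add: R_def)
        moreover have "q permutes {..<n}" using q(1) by (rule permutes_subset) (use n in auto)
        ultimately show ?thesis using permutes_compose[OF p] by blast
      qed
      ultimately show ?thesis by blast
    qed
  qed
qed

section \<open>Solvable graphs and their complements\<close>

text \<open>
  Every press in the complement of \<open>H\<close> toggles both of two isolated vertices of \<open>H\<close>, so if
  just one of their lights is on at first, the two lights differ forever.
\<close>
lemma solvable_imp_at_most_one_isolated:
  assumes "universally_solvable {..<n} ([{..<n}]\<^bsup>2\<^esup> - H)"
  shows "at_most_one_isolated n H"
  unfolding at_most_one_isolated_def
proof (intro allI impI, rule ccontr)
  fix x y assume xy: "x < n" "y < n" "x \<notin> \<Union>H" "y \<notin> \<Union>H" "x \<noteq> y"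
  let ?E = "[{..<n}]\<^bsup>2\<^esup> - H"
  have toggled: "z \<in> closed_nbhd {..<n} ?E v" if "z < n" "z \<notin> \<Union>H" "v < n" for z v
    using that by (auto simp: closed_nbhd_def)
  have "x \<in> fold (press {..<n} ?E) vs c \<longleftrightarrow> y \<notin> fold (press {..<n} ?E) vs c"
    if "set vs \<subseteq> {..<n}" "x \<in> c \<longleftrightarrow> y \<notin> c" for vs c
    using that
  proof (induction vs arbitrary: c)
    case (Cons v vs)
    have "x \<in> press {..<n} ?E v c \<longleftrightarrow> y \<notin> press {..<n} ?E v c"
      using Cons.prems toggled[of x v] toggled[of y v] xy by (auto simp: press_def)
    then show ?case using Cons.IH Cons.prems(1) by simp
  qed simp
  moreover obtain vs where "set vs \<subseteq> {..<n}" "fold (press {..<n} ?E) vs {x} = {}"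
    using assms xy(1) unfolding universally_solvable_def by (metis empty_subsetI insert_subset lessThan_iff)
  ultimately show False using xy(5) by (metis empty_iff singleton_iff)
qed

text \<open>
  The set \<open>c\<close> lies in the span of the closed neighbourhoods over the field with two elements.
\<close>
definition switchable :: "'a set \<Rightarrow> 'a set set \<Rightarrow> 'a set \<Rightarrow> bool" where
  "switchable V E c \<longleftrightarrow>
    (\<exists>vs. set vs \<subseteq> V \<and> (\<forall>d. fold (press V E) vs d = sym_diff d c))"

lemma switchable_empty: "switchable V E {}"
  unfolding switchable_def by (rule exI[of _ "[]"]) simp

lemma switchable_closed_nbhd: "v \<in> V \<Longrightarrow> switchable V E (closed_nbhd V E v)"
  unfolding switchable_def by (rule exI[of _ "[v]"]) (simp add: press_def)

lemma switchable_sym_diff: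
  assumes "switchable V E c" "switchable V E d"
  shows "switchable V E (sym_diff c d)"
proof -
  obtain vs where vs: "set vs \<subseteq> V" "\<forall>b. fold (press V E) vs b = sym_diff b c"
    using assms(1) unfolding switchable_def by (elim exE conjE)
  obtain ws where ws: "set ws \<subseteq> V" "\<forall>b. fold (press V E) ws b = sym_diff b d"
    using assms(2) unfolding switchable_def by (elim exE conjE)
  have "fold (press V E) (vs @ ws) b = sym_diff b (sym_diff c d)" for b
    by (simp add: vs(2) ws(2)) blast
  moreover have "set (vs @ ws) \<subseteq> V" using vs(1) ws(1) by simp
  ultimately show ?thesis unfolding switchable_def by (intro exI[of _ "vs @ ws"] conjI allI)
qed

lemma universally_solvable_if_switchable_singletons:
  assumes "finite V" "\<And>u. u \<in> V \<Longrightarrow> switchable V E {u}"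
  shows "universally_solvable V E"
  unfolding universally_solvable_def
proof (intro allI impI)
  fix c assume c: "c \<subseteq> V"
  have "switchable V E c"
    using finite_subset[OF c assms(1)] c
  proof (induction c rule: finite_induct)
    case (insert u c)
    then have "switchable V E (sym_diff {u} c)" using assms(2) by (intro switchable_sym_diff) auto
    moreover have "sym_diff {u} c = insert u c" using insert.hyps by auto
    ultimately show ?case by simp
  qed (rule switchable_empty)
  then obtain vs where "set vs \<subseteq> V" "\<forall>d. fold (press V E) vs d = sym_diff d c"
    unfolding switchable_def by (elim exE conjE)
  then show "\<exists>vs. set vs \<subseteq> V \<and> fold (press V E) vs c = {}" by (intro exI[of _ vs]) simp
qed

definition pair_matching :: "nat \<Rightarrow> nat set set" where
  "pair_matching K = (\<lambda>i. {2 * i, 2 * i + 1}) ` {..<K}"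

lemma pair_matching_labeled_graphs: "pair_matching (n div 2) \<in> labeled_graphs n (n div 2)"
proof -
  have "inj_on (\<lambda>i::nat. {2 * i, 2 * i + 1}) {..<n div 2}"
    by (auto simp: inj_on_def doubleton_eq_iff)
  then have "card (pair_matching (n div 2)) = n div 2"
    by (simp add: pair_matching_def card_image)
  then show ?thesis by (auto simp: labeled_graphs_def pair_matching_def)
qed

text \<open>
  Pressing a matched vertex toggles all vertices but its partner. Pressing both ends of a matching
  edge thus toggles just these two; so all matched vertices can be toggled together. If \<open>n\<close> is odd,
  pressing the unmatched vertex toggles all vertices. Hence each vertex can be toggled alone.
\<close>
lemma universally_solvable_complement_matching:
  "universally_solvable {..<n} ([{..<n}]\<^bsup>2\<^esup> - pair_matching (n div 2))"
proof (rule universally_solvable_if_switchable_singletons)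
  define K where "K = n div 2"
  define E where "E = [{..<n}]\<^bsup>2\<^esup> - pair_matching (n div 2)"
  have n: "n = 2 * K \<or> n = 2 * K + 1" unfolding K_def by linarith
  have "{2 * i, v} \<in> pair_matching K \<longleftrightarrow> v = 2 * i + 1" if "i < K" for i v
    using that by (auto simp: pair_matching_def doubleton_eq_iff image_iff; presburger)
  then have nb_even: "closed_nbhd {..<n} E (2 * i) = {..<n} - {2 * i + 1}" if "i < K" for i
    using that n unfolding closed_nbhd_def E_def K_def[symmetric] by (auto simp: insert_commute)
  have "{2 * i + 1, v} \<in> pair_matching K \<longleftrightarrow> v = 2 * i" if "i < K" for i v
    using that by (auto simp: pair_matching_def doubleton_eq_iff image_iff; presburger)
  then have nb_odd: "closed_nbhd {..<n} E (2 * i + 1) = {..<n} - {2 * i}" if "i < K" for i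
    using that n unfolding closed_nbhd_def E_def K_def[symmetric] by (auto simp: insert_commute)
  have but_even: "switchable {..<n} E ({..<n} - {2 * i})" if "i < K" for i
  proof -
    have "2 * i + 1 \<in> {..<n}" using that n by auto
    from switchable_closed_nbhd[OF this, of E] show ?thesis by (simp only: nb_odd[OF that])
  qed
  have but_odd: "switchable {..<n} E ({..<n} - {2 * i + 1})" if "i < K" for i
  proof -
    have "2 * i \<in> {..<n}" using that n by auto
    from switchable_closed_nbhd[OF this, of E] show ?thesis by (simp only: nb_even[OF that])
  qed
  have matched: "switchable {..<n} E {..<2 * j}" if "j \<le> K" for j
    using that
  proof (induction j)
    case (Suc j)
    then have "switchable {..<n} E
      (sym_diff {..<2 * j} (sym_diff ({..<n} - {2 * j}) ({..<n} - {2 * j + 1})))"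
      by (intro switchable_sym_diff but_even but_odd) auto
    moreover have "sym_diff {..<2 * j} (sym_diff ({..<n} - {2 * j}) ({..<n} - {2 * j + 1}))
      = {..<2 * Suc j}"
      using Suc.prems n by auto
    ultimately show ?case by simp
  qed (simp add: switchable_empty)
  have all: "switchable {..<n} E {..<n}"
  proof (cases "n = 2 * K")
    case False
    then have n_odd: "n = 2 * K + 1" using n by simp
    have "{u, 2 * K} \<notin> pair_matching K" for u
      by (auto simp: pair_matching_def doubleton_eq_iff)
    then have "closed_nbhd {..<n} E (2 * K) = {..<n}"
      unfolding closed_nbhd_def E_def K_def[symmetric] using n_odd by auto
    then show ?thesis using switchable_closed_nbhd[of "2 * K" "{..<n}" E] n_odd by simp
  qed (use matched[of K] in simp)
  show "switchable {..<n} ([{..<n}]\<^bsup>2\<^esup> - pair_matching (n div 2)) {u}" if "u \<in> {..<n}" for u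
  proof -
    have split: "{u} = sym_diff {..<n} ({..<n} - {u})" using that by auto
    have "switchable {..<n} E {u}"
    proof (cases "u < 2 * K")
      case True
      then have "u div 2 < K" "u = 2 * (u div 2) \<or> u = 2 * (u div 2) + 1" by auto
      then have "switchable {..<n} E ({..<n} - {u})" using but_even but_odd by metis
      then show ?thesis using switchable_sym_diff[OF all] split by metis
    next
      case False
      then have "n = 2 * K + 1" "u = 2 * K" using that n by auto
      then have "{u} = sym_diff {..<n} {..<2 * K}" by auto
      then show ?thesis using switchable_sym_diff[OF all matched[of K]] by simp
    qed
    then show ?thesis by (simp add: E_def)
  qed
qed simp

section \<open>Counting solvable graphs\<close>

definition solvable_classes :: "nat \<Rightarrow> nat \<Rightarrow> nat set set set set" where
  "solvable_classes n e = {C \<in> unlabeled_graphs n e. \<forall>E\<in>C. universally_solvable {..<n} E}"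

lemma unlabeled_graphs_member:
  assumes "C \<in> unlabeled_graphs n e" "E \<in> C"
  shows "E \<in> labeled_graphs n e" "C = iso_rel n e `` {E}"
proof -
  show "E \<in> labeled_graphs n e"
    using in_quotient_imp_subset[OF equiv_iso_rel] assms unfolding unlabeled_graphs_def by blast
  show "C = iso_rel n e `` {E}"
    using assms equiv_iso_rel[of n e] unfolding unlabeled_graphs_def
    by (metis Image_singleton_iff equiv_class_eq quotientE)
qed

lemma complement_labeled_graphs:
  assumes "E \<in> labeled_graphs n e"
  shows "[{..<n}]\<^bsup>2\<^esup> - E \<in> labeled_graphs n ((n choose 2) - e)"
proof -
  have "E \<subseteq> [{..<n}]\<^bsup>2\<^esup>" "card E = e" using assms by (auto simp: labeled_graphs_def)
  moreover have "finite E" using calculation(1) finite_imp_finite_nsets finite_subset by blast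
  ultimately show ?thesis
    by (simp add: labeled_graphs_def card_Diff_subset card_nsets_2)
qed

lemma solvable_class_complement:
  assumes "C \<in> solvable_classes n e"
  obtains E where "E \<in> C" "C \<in> unlabeled_graphs n e"
    "[{..<n}]\<^bsup>2\<^esup> - E \<in> labeled_graphs n ((n choose 2) - e)"
    "at_most_one_isolated n ([{..<n}]\<^bsup>2\<^esup> - E)"
proof -
  have C: "C \<in> unlabeled_graphs n e" using assms by (simp add: solvable_classes_def)
  then have "C \<noteq> {}"
    unfolding unlabeled_graphs_def by (rule in_quotient_imp_non_empty[OF equiv_iso_rel])
  then obtain E where E: "E \<in> C" by blast
  have lab: "E \<in> labeled_graphs n e" using unlabeled_graphs_member(1)[OF C E] .
  then have "[{..<n}]\<^bsup>2\<^esup> - ([{..<n}]\<^bsup>2\<^esup> - E) = E" by (auto simp: labeled_graphs_def)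
  then have "at_most_one_isolated n ([{..<n}]\<^bsup>2\<^esup> - E)"
    using assms E by (intro solvable_imp_at_most_one_isolated) (simp add: solvable_classes_def)
  then show ?thesis using that E C complement_labeled_graphs[OF lab] by blast
qed

lemma solvable_classes_empty:
  assumes "k < n div 2" "k \<le> n choose 2"
  shows "solvable_classes n ((n choose 2) - k) = {}"
proof (rule ccontr)
  assume "solvable_classes n ((n choose 2) - k) \<noteq> {}"
  then obtain C where "C \<in> solvable_classes n ((n choose 2) - k)" by blast
  then obtain H where "H \<in> labeled_graphs n k" "at_most_one_isolated n H"
    using solvable_class_complement assms(2) by (metis diff_diff_cancel)
  then show False using at_most_one_isolated_imp_le assms(1) by fastforce
qed

text \<open>
  Complements of solvable graphs have at most one isolated vertex, so they are relabelings of
  boundedly many representatives, and graphs with isomorphic complements are isomorphic.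
\<close>
lemma card_solvable_classes_le:
  assumes "2 * k \<le> n + 2 * m" "k \<le> n choose 2"
  shows "card (solvable_classes n ((n choose 2) - k)) \<le> 2 ^ (6 * m + 5)\<^sup>2"
proof -
  let ?X = "[{..<n}]\<^bsup>2\<^esup>" and ?e = "(n choose 2) - k"
  obtain R where R: "R \<subseteq> labeled_graphs n k" "card R \<le> 2 ^ (6 * m + 5)\<^sup>2"
    "\<And>H. H \<in> labeled_graphs n k \<Longrightarrow> at_most_one_isolated n H \<Longrightarrow>
      \<exists>p. p permutes {..<n} \<and> relabel p H \<in> R"
    using bounded_representatives[OF assms(1)] by blast
  define represents where "represents C r \<longleftrightarrow>
    (\<exists>E\<in>C. \<exists>p. p permutes {..<n} \<and> relabel p (?X - E) = r)" for C r
  have "\<exists>r\<in>R. represents C r" if C: "C \<in> solvable_classes n ?e" for C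
  proof -
    obtain E where E: "E \<in> C" "?X - E \<in> labeled_graphs n k" "at_most_one_isolated n (?X - E)"
      using solvable_class_complement[OF C] assms(2) by (metis diff_diff_cancel)
    show ?thesis using R(3)[OF E(2,3)] E(1) unfolding represents_def by blast
  qed
  then obtain f where f: "\<And>C. C \<in> solvable_classes n ?e \<Longrightarrow> f C \<in> R \<and> represents C (f C)"
    by metis
  have same: "C = D" if C: "C \<in> unlabeled_graphs n ?e" and D: "D \<in> unlabeled_graphs n ?e"
    and r: "represents C r" "represents D r" for C D r
  proof -
    obtain E p where E: "E \<in> C" "p permutes {..<n}" "relabel p (?X - E) = r"
      using r(1) unfolding represents_def by blast
    obtain F q where F: "F \<in> D" "q permutes {..<n}" "relabel q (?X - F) = r"
      using r(2) unfolding represents_def by blast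
    have E_lab: "E \<in> labeled_graphs n ?e" using unlabeled_graphs_member(1)[OF C E(1)] .
    have F_lab: "F \<in> labeled_graphs n ?e" using unlabeled_graphs_member(1)[OF D F(1)] .
    have sub: "E \<subseteq> ?X" "F \<subseteq> ?X" using E_lab F_lab by (auto simp: labeled_graphs_def)
    have "relabel p E \<subseteq> ?X" "relabel q F \<subseteq> ?X" 
      using relabel_subset[OF E(2) sub(1)] relabel_subset[OF F(2) sub(2)] by simp_all
    moreover have "?X - relabel p E = ?X - relabel q F"
      using E(3) F(3) relabel_complement[OF E(2), of E] relabel_complement[OF F(2), of F] by simp
    ultimately have "relabel p E = relabel q F" by blast
    then have "relabel (inv q \<circ> p) E = F"
      using relabel_inv(1)[OF F(2), of F] by (simp flip: relabel_comp)
    moreover have "inv q \<circ> p permutes {..<n}"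
      using permutes_compose[OF E(2) permutes_inv[OF F(2)]] .
    ultimately have "(E, F) \<in> iso_rel n ?e" using E_lab F_lab by (auto simp: iso_rel_iff)
    then have "iso_rel n ?e `` {E} = iso_rel n ?e `` {F}"
      by (rule equiv_class_eq[OF equiv_iso_rel])
    then show ?thesis
      using unlabeled_graphs_member(2)[OF C E(1)] unlabeled_graphs_member(2)[OF D F(1)] by simp
  qed
  have "inj_on f (solvable_classes n ?e)"
  proof (rule inj_onI)
    fix C D assume CD: "C \<in> solvable_classes n ?e" "D \<in> solvable_classes n ?e" "f C = f D"
    then show "C = D"
      using same[of C D "f C"] f[of C] f[of D] by (simp add: solvable_classes_def)
  qed
  moreover have "finite R" using R(1) finite_labeled_graphs finite_subset by blast
  ultimately have "card (solvable_classes n ?e) \<le> card R"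
    using f by (intro card_inj_on_le[of f]) auto
  then show ?thesis using R(2) by simp
qed

lemma solvable_classes_matching_nonempty:
  "solvable_classes n ((n choose 2) - n div 2) \<noteq> {}"
proof -
  let ?E = "[{..<n}]\<^bsup>2\<^esup> - pair_matching (n div 2)" and ?e = "(n choose 2) - n div 2"
  have E: "?E \<in> labeled_graphs n ?e"
    using complement_labeled_graphs[OF pair_matching_labeled_graphs] .
  then have C: "iso_rel n ?e `` {?E} \<in> unlabeled_graphs n ?e"
    unfolding unlabeled_graphs_def by (rule quotientI)
  moreover have "?E \<in> iso_rel n ?e `` {?E}"
    using E equiv_class_self[OF equiv_iso_rel] by blast
  ultimately have "iso_rel n ?e `` {?E} \<in> solvable_classes n ?e"
    using universally_solvable_class_iff universally_solvable_complement_matching[of n]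
    by (simp add: solvable_classes_def)
  then show ?thesis by blast
qed

lemma solvable_prob_eq:
  "solvable_prob n e = card (solvable_classes n e) / card (unlabeled_graphs n e)"
  by (simp add: solvable_prob_def solvable_classes_def)

theorem theorem7p1:
  fixes m :: nat
  assumes "m > 0"
  shows "\<exists>M::nat. M > 0 \<and>
    (\<forall>n>M. let N = n choose 2 in
      \<forall>e::nat. int N - int (n div 2) - int m \<le> int e \<and> e \<le> N \<longrightarrow>
        solvable_prob n e \<le> solvable_prob n (N - n div 2))"
proof -
  define c :: nat where "c = 2 ^ (6 * m + 5)\<^sup>2"
  have c: "c \<ge> 1" by (simp add: c_def)
  obtain M where M: "\<And>n k. M \<le> n \<Longrightarrow> n \<le> 3 * k \<Longrightarrow> k \<le> n \<Longrightarrow>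
      c * card (unlabeled_graphs n k) \<le> card (unlabeled_graphs n (k + 1))"
    using unlabeled_graphs_growth_rate[of c] by blast
  \<comment> \<open>The summand \<open>2 * m\<close> ensures \<open>n div 2 + m \<le> n\<close>, so the growth rate applies up to this \<open>k\<close>.\<close>
  have main: "solvable_prob n e \<le> solvable_prob n ((n choose 2) - n div 2)"
    if n: "M + 2 * m + 3 < n" and e: "(n choose 2) \<le> e + n div 2 + m" "e \<le> n choose 2" for n e
  proof -
    define N K k where "N = n choose 2" and "K = n div 2" and "k = N - e"
    let ?g = "\<lambda>k. card (unlabeled_graphs n k)"
    have e_eq: "e = N - k" and kN: "k \<le> N" and kK: "k \<le> K + m"
      using e by (auto simp: N_def K_def k_def)
    have KN: "K \<le> N"
      using card_mono[of "[{..<n}]\<^bsup>2\<^esup>" "pair_matching K"] pair_matching_labeled_graphs[of n]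
      by (simp add: N_def K_def labeled_graphs_def card_nsets_2 finite_imp_finite_nsets)
    have nK: "2 * K \<le> n" "n \<le> 3 * K" "K + m \<le> n" using n unfolding K_def by linarith+
    have "solvable_classes n (N - K) \<noteq> {}"
      using solvable_classes_matching_nonempty by (simp add: N_def K_def)
    moreover have "finite (solvable_classes n (N - K))"
      unfolding solvable_classes_def using finite_unlabeled_graphs by simp
    ultimately have one: "1 \<le> card (solvable_classes n (N - K))"
      by (simp add: Suc_leI card_gt_0_iff)
    also have "\<dots> \<le> ?g (N - K)"
      unfolding solvable_classes_def using finite_unlabeled_graphs by (intro card_mono) auto
    also have "\<dots> = ?g K" using card_unlabeled_graphs_complement KN by (simp add: N_def)
    finally have gK: "1 \<le> ?g K" .
    have PK: "1 / ?g K \<le> solvable_prob n (N - K)"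
    proof -
      have "?g (N - K) = ?g K" using card_unlabeled_graphs_complement KN by (simp add: N_def)
      then show ?thesis using one by (simp add: solvable_prob_eq divide_right_mono)
    qed
    have growth: "c * ?g K \<le> ?g (K + Suc j)" if "Suc j \<le> m" for j
      using that
    proof (induction j)
      case 0
      then show ?case using M[of n K] n nK by simp
    next
      case (Suc j)
      have "1 * ?g (K + Suc j) \<le> c * ?g (K + Suc j)" using c by (rule mult_right_mono) simp
      also have "\<dots> \<le> ?g (K + Suc j + 1)" using M[of n "K + Suc j"] n nK Suc.prems by simp
      finally show ?case using Suc by simp
    qed
    consider "k < K" | "k = K" | j where "k = K + Suc j"
      by (metis less_iff_Suc_add linorder_neqE_nat add_Suc_right)
    then have "solvable_prob n e \<le> solvable_prob n (N - K)"
    proof cases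
      case 1
      then have "solvable_prob n e = 0"
        using solvable_classes_empty[of k n] kN by (simp add: solvable_prob_eq e_eq N_def K_def)
      moreover have "0 \<le> solvable_prob n (N - K)" by (simp add: solvable_prob_eq)
      ultimately show ?thesis by simp
    next
      case 2
      then show ?thesis by (simp add: e_eq)
    next
      case 3
      have ge: "?g e = ?g k" using card_unlabeled_graphs_complement kN by (simp add: e_eq N_def)
      have cg: "c * ?g K \<le> ?g k" using growth[of j] 3 kK by simp
      have "card (solvable_classes n e) \<le> c"
        using card_solvable_classes_le[of k n m] kK nK(1) kN by (simp add: c_def e_eq N_def)
      then have "solvable_prob n e \<le> real c / real (?g k)"
        unfolding solvable_prob_eq ge by (intro divide_right_mono) auto
      also have "\<dots> \<le> real c / real (c * ?g K)"
      proof (rule divide_left_mono)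
        have pos: "0 < c * ?g K" using c gK by simp
        then have "0 < ?g k" using cg by linarith
        then show "0 < real (?g k) * real (c * ?g K)"
          using pos by (intro mult_pos_pos) (simp_all only: of_nat_0_less_iff)
        show "real (c * ?g K) \<le> real (?g k)" using cg by (rule of_nat_mono)
      qed simp
      also have "\<dots> = 1 / ?g K" using c by simp
      finally show ?thesis using PK by simp
    qed
    then show ?thesis by (simp add: N_def K_def)
  qed
  show ?thesis
    unfolding Let_def
  proof (intro exI[of _ "M + 2 * m + 3"] conjI allI impI)
    fix n e :: nat
    assume "M + 2 * m + 3 < n"
      "int (n choose 2) - int (n div 2) - int m \<le> int e \<and> e \<le> n choose 2"
    then show "solvable_prob n e \<le> solvable_prob n ((n choose 2) - n div 2)"
      by (intro main) linarith+
  qed simp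
qed

end
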